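(* Let $I$ be a closed ideal of the Banach lattice $E$. If $I$ and the quotient lattice $E/I$ have the dual positive Schur property, then $E$ has the dual positive Schur property.
   Context: A Banach lattice $E$ has the dual positive Schur property if every weak$^*$-null sequence formed by positive functionals in $E^*$ is norm null. The quotient $E/I$ is a Banach lattice with the quotient norm and the quotient order ($\dot x\le\dot y$ if there are $x_1\in\dot x$, $y_1\in\dot y$ with $x_1\le y_1$). *)

theory Defs
  imports "HOL-Analysis.Analysis" "HOL-Library.Lattice_Algebras"
begin

class banach_lattice = banach + ordered_real_vector + lattice_ab_group_add_abs +
  assumes norm_le_if_abs_le: "\<bar>x\<bar> \<le> \<bar>y\<bar> \<Longrightarrow> norm x \<le> norm y"

instance real :: banach_lattice
  by standard simp

definition closed_ideal :: "'a::banach_lattice set \<Rightarrow> bool" where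
  "closed_ideal I \<longleftrightarrow> subspace I \<and> closed I \<and> (\<forall>x y. y \<in> I \<longrightarrow> \<bar>x\<bar> \<le> \<bar>y\<bar> \<longrightarrow> x \<in> I)"


text \<open>
  The space E is a type, but an ideal I and the quotient E/I depend on the value I and are
  therefore not types. So that a single definition of the dual positive Schur property applies to
  all three, an ordered normed space is given by a carrier and its operations. Only the
  behaviour on the carrier matters. Completeness and the lattice operations play no role in the
  property itself and are not recorded.
\<close>

record 'b ordered_normed_space =
  carrier :: "'b set"
  zero_vec :: "'b"
  add_vec :: "'b \<Rightarrow> 'b \<Rightarrow> 'b"
  scale_vec :: "real \<Rightarrow> 'b \<Rightarrow> 'b"
  norm_vec :: "'b \<Rightarrow> real"
  le_vec :: "'b \<Rightarrow> 'b \<Rightarrow> bool"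

definition dual_space :: "'b ordered_normed_space \<Rightarrow> ('b \<Rightarrow> real) set" where
  "dual_space V = {f.
     (\<forall>x\<in>carrier V. \<forall>y\<in>carrier V. f (add_vec V x y) = f x + f y) \<and>
     (\<forall>c. \<forall>x\<in>carrier V. f (scale_vec V c x) = c * f x) \<and>
     (\<exists>K. \<forall>x\<in>carrier V. \<bar>f x\<bar> \<le> K * norm_vec V x)}"

definition dual_norm :: "'b ordered_normed_space \<Rightarrow> ('b \<Rightarrow> real) \<Rightarrow> real" where
  "dual_norm V f = (SUP x\<in>{x \<in> carrier V. norm_vec V x \<le> 1}. \<bar>f x\<bar>)"

definition positive_functional :: "'b ordered_normed_space \<Rightarrow> ('b \<Rightarrow> real) \<Rightarrow> bool" where
  "positive_functional V f \<longleftrightarrow> (\<forall>x\<in>carrier V. le_vec V (zero_vec V) x \<longrightarrow> 0 \<le> f x)"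

definition weak_star_null :: "'b ordered_normed_space \<Rightarrow> (nat \<Rightarrow> 'b \<Rightarrow> real) \<Rightarrow> bool" where
  "weak_star_null V f \<longleftrightarrow> (\<forall>x\<in>carrier V. (\<lambda>n. f n x) \<longlonglongrightarrow> 0)"

definition norm_null :: "'b ordered_normed_space \<Rightarrow> (nat \<Rightarrow> 'b \<Rightarrow> real) \<Rightarrow> bool" where
  "norm_null V f \<longleftrightarrow> (\<lambda>n. dual_norm V (f n)) \<longlonglongrightarrow> 0"

definition dual_positive_Schur :: "'b ordered_normed_space \<Rightarrow> bool" where
  "dual_positive_Schur V \<longleftrightarrow>
     (\<forall>f :: nat \<Rightarrow> 'b \<Rightarrow> real.
        (\<forall>n. f n \<in> dual_space V \<and> positive_functional V (f n)) \<longrightarrow>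
        weak_star_null V f \<longrightarrow> norm_null V f)"


definition sub_lattice :: "'a::banach_lattice set \<Rightarrow> 'a ordered_normed_space" where
  "sub_lattice S = \<lparr>carrier = S, zero_vec = 0, add_vec = (+), scale_vec = (*\<^sub>R),
     norm_vec = norm, le_vec = (\<le>)\<rparr>"

lemma sub_lattice_simps [simp]:
  "carrier (sub_lattice S) = S" "zero_vec (sub_lattice S) = 0" "add_vec (sub_lattice S) = (+)"
  "scale_vec (sub_lattice S) = (*\<^sub>R)" "norm_vec (sub_lattice S) = norm"
  "le_vec (sub_lattice S) = (\<le>)"
  by (simp_all add: sub_lattice_def)

abbreviation whole_lattice :: "'a::banach_lattice ordered_normed_space" where
  "whole_lattice \<equiv> sub_lattice UNIV"

definition coset :: "'a::banach_lattice set \<Rightarrow> 'a \<Rightarrow> 'a set" where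
  "coset I x = {x + i | i. i \<in> I}"

text \<open>
  In the scalar multiplication, the summand from I only matters for the scalar 0, where the
  set of all multiples is {0} instead of the zero coset I.
\<close>

definition quotient_lattice :: "'a::banach_lattice set \<Rightarrow> 'a set ordered_normed_space" where
  "quotient_lattice I = \<lparr>carrier = range (coset I), zero_vec = I,
     add_vec = (\<lambda>A B. {a + b | a b. a \<in> A \<and> b \<in> B}),
     scale_vec = (\<lambda>c A. {c *\<^sub>R a + i | a i. a \<in> A \<and> i \<in> I}),
     norm_vec = (\<lambda>A. INF a\<in>A. norm a),
     le_vec = (\<lambda>A B. \<exists>a\<in>A. \<exists>b\<in>B. a \<le> b)\<rparr>"

text \<open>The quotient operations are the usual ones on representatives.\<close>

lemma quotient_lattice_simps:
  assumes "closed_ideal (I :: 'a::banach_lattice set)"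
  shows "zero_vec (quotient_lattice I) = coset I 0"
    and "add_vec (quotient_lattice I) (coset I x) (coset I y) = coset I (x + y)"
    and "scale_vec (quotient_lattice I) c (coset I x) = coset I (c *\<^sub>R x)"
    and "norm_vec (quotient_lattice I) (coset I x) = infdist x I"
    and "le_vec (quotient_lattice I) (coset I x) (coset I y) \<longleftrightarrow> (\<exists>i\<in>I. x \<le> y + i)"
    and "coset I x = coset I y \<longleftrightarrow> x - y \<in> I"
proof -
  have I: "subspace I" using assms by (simp add: closed_ideal_def)
  note sub = subspace_0[OF I] subspace_add[OF I] subspace_scale[OF I] subspace_diff[OF I]
    subspace_neg[OF I]
  show "zero_vec (quotient_lattice I) = coset I 0"
    by (simp add: quotient_lattice_def coset_def)
  have mem: "z \<in> coset I w \<longleftrightarrow> z - w \<in> I" for z w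
    by (auto simp: coset_def intro: exI[of _ "z - w"])
  show "add_vec (quotient_lattice I) (coset I x) (coset I y) = coset I (x + y)"
  proof (rule set_eqI)
    fix z
    have "z - (x + y) \<in> I" if "z = a + b" "a - x \<in> I" "b - y \<in> I" for a b
      using sub(2)[OF that(2,3)] that(1) by (simp add: algebra_simps)
    moreover have "z = (z - y) + y" "(z - y) - x = z - (x + y)" "y - y \<in> I"
      using sub(1) by (simp_all add: algebra_simps)
    ultimately show "z \<in> add_vec (quotient_lattice I) (coset I x) (coset I y)
        \<longleftrightarrow> z \<in> coset I (x + y)"
      unfolding quotient_lattice_def ordered_normed_space.simps mem_Collect_eq mem by metis
  qed
  show "scale_vec (quotient_lattice I) c (coset I x) = coset I (c *\<^sub>R x)"
  proof (rule set_eqI)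
    fix z
    have "z - c *\<^sub>R x \<in> I" if "z = c *\<^sub>R a + i" "a - x \<in> I" "i \<in> I" for a i
      using sub(2)[OF sub(3)[OF that(2), of c] that(3)] that(1) by (simp add: algebra_simps)
    moreover have "z = c *\<^sub>R x + (z - c *\<^sub>R x)" "x - x \<in> I"
      using sub(1) by simp_all
    ultimately show "z \<in> scale_vec (quotient_lattice I) c (coset I x)
        \<longleftrightarrow> z \<in> coset I (c *\<^sub>R x)"
      unfolding quotient_lattice_def ordered_normed_space.simps mem_Collect_eq mem by metis
  qed
  have "norm ` coset I x = dist x ` I"
  proof (intro set_eqI iffI)
    fix r assume "r \<in> norm ` coset I x"
    then obtain i where "i \<in> I" "r = norm (x + i)" by (auto simp: coset_def)
    then show "r \<in> dist x ` I"
      using sub(5) by (intro image_eqI[of _ _ "- i"]) (auto simp: dist_norm)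
  next
    fix r assume "r \<in> dist x ` I"
    then obtain i where "i \<in> I" "r = norm (x - i)" by (auto simp: dist_norm)
    then show "r \<in> norm ` coset I x"
      using sub(5) unfolding coset_def
      by (intro image_eqI[of _ _ "x + - i"]) auto
  qed
  moreover have "I \<noteq> {}" using sub(1) by blast
  ultimately show "norm_vec (quotient_lattice I) (coset I x) = infdist x I"
    by (simp add: quotient_lattice_def infdist_def)
  show "le_vec (quotient_lattice I) (coset I x) (coset I y) \<longleftrightarrow> (\<exists>i\<in>I. x \<le> y + i)"
  proof
    assume "le_vec (quotient_lattice I) (coset I x) (coset I y)"
    then obtain i j where "i \<in> I" "j \<in> I" "x + i \<le> y + j"
      by (auto simp: quotient_lattice_def coset_def)
    then show "\<exists>i\<in>I. x \<le> y + i"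
      using sub(4) by (intro bexI[of _ "j - i"]) (auto simp: algebra_simps)
  next
    assume "\<exists>i\<in>I. x \<le> y + i"
    then obtain i where i: "i \<in> I" "x \<le> y + i" by blast
    have "x \<in> coset I x" "y + i \<in> coset I y"
      using i(1) sub(1) by (auto simp: coset_def intro: exI[of _ 0])
    then show "le_vec (quotient_lattice I) (coset I x) (coset I y)"
      using i(2) unfolding quotient_lattice_def by auto
  qed
  show "coset I x = coset I y \<longleftrightarrow> x - y \<in> I"
  proof
    assume "coset I x = coset I y"
    moreover have "x \<in> coset I x" using sub(1) by (auto simp: coset_def intro: exI[of _ 0])
    ultimately obtain i where "i \<in> I" "x = y + i" by (auto simp: coset_def)
    then show "x - y \<in> I" by simp
  next
    assume d: "x - y \<in> I"
    have "\<exists>j\<in>I. x + i = y + j" if "i \<in> I" for i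
      using sub(2)[OF d that] by (intro bexI[of _ "(x - y) + i"]) auto
    moreover have "\<exists>j\<in>I. y + i = x + j" if "i \<in> I" for i
      using sub(4)[OF that d] by (intro bexI[of _ "i - (x - y)"]) auto
    ultimately show "coset I x = coset I y"
      unfolding coset_def by blast
  qed
qed

text \<open>On the whole space the property is the familiar one for bounded linear functionals.\<close>

lemma dual_norm_whole_lattice:
  fixes f :: "'a::banach_lattice \<Rightarrow>\<^sub>L real"
  shows "dual_norm whole_lattice (blinfun_apply f) = norm f"
proof (rule antisym)
  have bdd: "bdd_above ((\<lambda>x. \<bar>blinfun_apply f x\<bar>) ` {x. norm x \<le> 1})"
  proof (rule bdd_aboveI2[where M = "norm f"])
    fix x :: 'a assume "x \<in> {x. norm x \<le> 1}"
    then show "\<bar>blinfun_apply f x\<bar> \<le> norm f"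
      using norm_blinfun[of f x] mult_left_mono[of "norm x" 1 "norm f"] by simp
  qed
  show "dual_norm whole_lattice (blinfun_apply f) \<le> norm f"
    unfolding dual_norm_def
  proof (simp, rule cSUP_least)
    show "{x::'a. norm x \<le> 1} \<noteq> {}" by (auto intro: exI[of _ 0])
    fix x :: 'a assume "x \<in> {x. norm x \<le> 1}"
    then show "\<bar>blinfun_apply f x\<bar> \<le> norm f"
      using norm_blinfun[of f x] mult_left_mono[of "norm x" 1 "norm f"] by simp
  qed
  have le: "\<bar>blinfun_apply f x\<bar> \<le> dual_norm whole_lattice (blinfun_apply f)"
    if "norm x \<le> 1" for x
    unfolding dual_norm_def using that cSUP_upper[OF _ bdd, of x] by simp
  have nn: "0 \<le> dual_norm whole_lattice (blinfun_apply f)"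
    using le[of 0] by simp
  show "norm f \<le> dual_norm whole_lattice (blinfun_apply f)"
  proof (rule norm_blinfun_bound[OF nn])
    fix x :: 'a
    show "norm (blinfun_apply f x) \<le> dual_norm whole_lattice (blinfun_apply f) * norm x"
    proof (cases "x = 0")
      case False
      then have "\<bar>blinfun_apply f (x /\<^sub>R norm x)\<bar> \<le> dual_norm whole_lattice (blinfun_apply f)"
        by (intro le) simp
      with False show ?thesis
        by (simp add: blinfun.scaleR_right abs_mult field_simps)
    qed simp
  qed
qed

lemma dual_space_whole_lattice:
  "dual_space (whole_lattice :: 'a::banach_lattice ordered_normed_space)
     = {f. bounded_linear f}"
  by (auto simp: dual_space_def bounded_linear_def bounded_linear_axioms_def
      linear_iff mult.commute)

lemma dual_positive_Schur_whole_lattice: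
  "dual_positive_Schur (whole_lattice :: 'a::banach_lattice ordered_normed_space) \<longleftrightarrow>
     (\<forall>f :: nat \<Rightarrow> 'a \<Rightarrow>\<^sub>L real.
        (\<forall>n x. 0 \<le> x \<longrightarrow> 0 \<le> blinfun_apply (f n) x) \<longrightarrow>
        (\<forall>x. (\<lambda>n. blinfun_apply (f n) x) \<longlonglongrightarrow> 0) \<longrightarrow> f \<longlonglongrightarrow> 0)"
  (is "?L \<longleftrightarrow> ?R")
proof
  assume L: ?L
  show ?R
  proof (intro allI impI)
    fix f :: "nat \<Rightarrow> 'a \<Rightarrow>\<^sub>L real"
    assume "\<forall>n x. 0 \<le> x \<longrightarrow> 0 \<le> blinfun_apply (f n) x"
      and "\<forall>x. (\<lambda>n. blinfun_apply (f n) x) \<longlonglongrightarrow> 0"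
    then have "norm_null whole_lattice (\<lambda>n. blinfun_apply (f n))"
      using L unfolding dual_positive_Schur_def
      by (simp add: dual_space_whole_lattice blinfun.bounded_linear_right
          positive_functional_def weak_star_null_def)
    then show "f \<longlonglongrightarrow> 0"
      by (simp add: norm_null_def dual_norm_whole_lattice tendsto_norm_zero_iff)
  qed
next
  assume R: ?R
  show ?L
    unfolding dual_positive_Schur_def
  proof (intro allI impI)
    fix g :: "nat \<Rightarrow> 'a \<Rightarrow> real"
    assume 1: "\<forall>n. g n \<in> dual_space whole_lattice \<and> positive_functional whole_lattice (g n)"
      and 2: "weak_star_null whole_lattice g"
    define f where "f = (\<lambda>n. Blinfun (g n))"
    have g: "g n = blinfun_apply (f n)" for n
      using 1 by (simp add: f_def bounded_linear_Blinfun_apply dual_space_whole_lattice)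
    have "f \<longlonglongrightarrow> 0"
      using R 1 2 by (simp add: g positive_functional_def weak_star_null_def)
    then show "norm_null whole_lattice g"
      by (simp add: norm_null_def g dual_norm_whole_lattice tendsto_norm_zero_iff)
  qed
qed

end

(* Restrict a weak*-null positive sequence f n to I; there it is norm null. Its minimal positive
   extension g n from I to the whole space, g x = sup {f y | y : I, 0 <= y <= x} for x >= 0, has
   the norm of the restriction and lies below f n. Hence f n - g n is positive, weak*-null and
   vanishes on I, so it factors through the quotient and is norm null as well. *)

theory Submission
  imports Defs
begin

section \<open>Order and norm in the lattice and in its ideals\<close>

lemma norm_mono_positive:
  fixes x y :: "'a::banach_lattice"
  assumes "0 \<le> x" "x \<le> y"
  shows "norm x \<le> norm y"
  using assms order_trans[OF assms] by (intro norm_le_if_abs_le) simp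

lemma norm_abs_lattice:
  fixes x :: "'a::banach_lattice"
  shows "norm \<bar>x\<bar> = norm x"
  by (intro antisym norm_le_if_abs_le) simp_all

lemma closed_ideal_imp_subspace: "closed_ideal I \<Longrightarrow> subspace I"
  by (simp add: closed_ideal_def)

lemma closed_ideal_between:
  assumes "closed_ideal I" "y \<in> I" "0 \<le> x" "x \<le> y"
  shows "x \<in> I"
  using assms order_trans[OF assms(3,4)] unfolding closed_ideal_def by (metis abs_of_nonneg)

section \<open>The dual norm as an operator bound\<close>

text \<open>A real supremum bounds its members only if the set is bounded above; the constant from
  \<open>dual_space\<close> provides that. Nonnegativity of the norm is assumed because the record
  carries no axioms.\<close>

lemma dual_norm_upper:
  assumes f: "f \<in> dual_space V"
    and nonneg: "\<And>y. y \<in> carrier V \<Longrightarrow> 0 \<le> norm_vec V y"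
    and x: "x \<in> carrier V" "norm_vec V x \<le> 1"
  shows "\<bar>f x\<bar> \<le> dual_norm V f"
proof -
  obtain K where K: "\<And>y. y \<in> carrier V \<Longrightarrow> \<bar>f y\<bar> \<le> K * norm_vec V y"
    using f unfolding dual_space_def by blast
  have "bdd_above ((\<lambda>x. \<bar>f x\<bar>) ` {x \<in> carrier V. norm_vec V x \<le> 1})"
  \<comment> \<open>\<open>K\<close> may be negative, whereas using
    \<open>norm_vec V y \<le> 1\<close> requires a nonnegative factor.\<close>
  proof (rule bdd_aboveI2[where M = "\<bar>K\<bar>"])
    fix y assume y: "y \<in> {x \<in> carrier V. norm_vec V x \<le> 1}"
    have "\<bar>f y\<bar> \<le> K * norm_vec V y" using K y by simp
    also have "\<dots> \<le> \<bar>K\<bar> * norm_vec V y"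
      using nonneg y by (intro mult_right_mono) auto
    also have "\<dots> \<le> \<bar>K\<bar>"
      using y by (intro mult_left_le) auto
    finally show "\<bar>f y\<bar> \<le> \<bar>K\<bar>" .
  qed
  then show ?thesis
    unfolding dual_norm_def using x by (intro cSUP_upper) auto
qed

text \<open>By homogeneity it suffices to normalise \<open>x\<close>, which stays in the subspace
  \<open>S\<close>. With \<open>S\<close> as a parameter the estimate serves both the ideal and the
  whole space.\<close>

lemma bound_from_unit_ball:
  fixes f :: "'a::real_normed_vector \<Rightarrow> real"
  assumes "bounded_linear f" "subspace S"
    and M: "\<And>x. x \<in> S \<Longrightarrow> norm x \<le> 1 \<Longrightarrow> \<bar>f x\<bar> \<le> M"
    and x: "x \<in> S"
  shows "\<bar>f x\<bar> \<le> M * norm x"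
proof (cases "x = 0")
  case True
  then show ?thesis using linear_0[OF bounded_linear.linear[OF assms(1)]] by simp
next
  case False
  have "\<bar>f (x /\<^sub>R norm x)\<bar> \<le> M"
    using assms(2) x False by (intro M) (auto simp: subspace_scale)
  then show ?thesis
    using False linear_scale[OF bounded_linear.linear[OF assms(1)]]
    by (simp add: abs_mult field_simps)
qed

lemma bounded_linear_in_dual_space_sub_lattice:
  assumes "bounded_linear f"
  shows "f \<in> dual_space (sub_lattice S)"
proof -
  interpret bounded_linear f by fact
  obtain K where "\<forall>x. norm (f x) \<le> norm x * K" using bounded by blast
  then show ?thesis
    unfolding dual_space_def by (auto simp: add scale mult.commute intro!: exI[of _ K])
qed

lemma bound_dual_norm_sub_lattice:
  assumes "bounded_linear f" "subspace S" "x \<in> S"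
  shows "\<bar>f x\<bar> \<le> dual_norm (sub_lattice S) f * norm x"
  using assms(1,2) _ assms(3)
proof (rule bound_from_unit_ball)
  fix y assume "y \<in> S" "norm y \<le> 1"
  then show "\<bar>f y\<bar> \<le> dual_norm (sub_lattice S) f"
    using bounded_linear_in_dual_space_sub_lattice[OF assms(1), of S]
    by (intro dual_norm_upper) simp_all
qed

lemma dual_norm_sub_lattice_nonneg:
  assumes "bounded_linear f" "subspace S"
  shows "0 \<le> dual_norm (sub_lattice S) f"
  using dual_norm_upper[OF bounded_linear_in_dual_space_sub_lattice[OF assms(1), of S], of 0]
    subspace_0[OF assms(2)] by simp

section \<open>Extending positive functionals from the ideal\<close>

text \<open>Kantorovich's extension: every vector is a difference of positive ones, and additivity
  of \<open>G\<close> makes \<open>G a - G b\<close> depend on \<open>a - b\<close> only.\<close>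

lemma positive_cone_extension:
  fixes G :: "'a::banach_lattice \<Rightarrow> real"
  assumes add: "\<And>x y. 0 \<le> x \<Longrightarrow> 0 \<le> y \<Longrightarrow> G (x + y) = G x + G y"
    and scale: "\<And>c x. 0 < c \<Longrightarrow> 0 \<le> x \<Longrightarrow> G (c *\<^sub>R x) = c * G x"
  obtains g where "linear g" "\<And>x. 0 \<le> x \<Longrightarrow> g x = G x"
proof
  define g where "g = (\<lambda>x. G (pprt x) - G (- nprt x))"
  \<comment> \<open>Independence of the decomposition: equating two differences and moving the
    negative terms across leaves sums of positive vectors, on which \<open>G\<close> is additive.
    Linearity of \<open>g\<close> is then read off from convenient decompositions.\<close>
  have g_diff: "g (a - b) = G a - G b" if "0 \<le> a" "0 \<le> b" for a b
  proof -
    have "pprt (a - b) + b = a + (- nprt (a - b))"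
      using prts[of "a - b"] by (simp add: algebra_simps)
    then have "G (pprt (a - b)) + G b = G a + G (- nprt (a - b))"
      using that add[of "pprt (a - b)" b] add[of a "- nprt (a - b)"] by simp
    then show ?thesis by (simp add: g_def)
  qed
  have G0: "G 0 = 0" using add[of 0 0] by simp
  show "g x = G x" if "0 \<le> x" for x
    using g_diff[of x 0] that G0 by simp
  have split: "x = pprt x - (- nprt x)" "0 \<le> pprt x" "0 \<le> - nprt x" for x :: 'a
    using prts[of x] by simp_all
  have g_add: "g (x + y) = g x + g y" for x y
  proof -
    have "(pprt x + pprt y) - (- nprt x + - nprt y) = (pprt x + nprt x) + (pprt y + nprt y)"
      by (simp add: algebra_simps)
    then have "x + y = (pprt x + pprt y) - (- nprt x + - nprt y)"
      by (simp only: prts[symmetric])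
    then have "g (x + y) = G (pprt x + pprt y) - G (- nprt x + - nprt y)"
      using g_diff[OF add_nonneg_nonneg add_nonneg_nonneg, OF split(2) split(2) split(3) split(3)]
      by (simp only:)
    then show ?thesis
      using add[OF split(2) split(2), of x y] add[OF split(3) split(3), of x y]
      by (simp only: g_def)
  qed
  have g_minus: "g (- x) = - g x" for x
  proof -
    have "- nprt x - pprt x = - (pprt x + nprt x)" by simp
    then have "- x = - nprt x - pprt x" by (simp only: prts[symmetric])
    then have "g (- x) = G (- nprt x) - G (pprt x)"
      using g_diff[OF split(3) split(2), of x x] by (simp only:)
    then show ?thesis by (simp add: g_def)
  qed
  have g_pos: "g (c *\<^sub>R x) = c * g x" if "0 < c" for c x
  proof -
    have "c *\<^sub>R x = c *\<^sub>R pprt x - c *\<^sub>R (- nprt x)"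
      using split(1)[of x] by (metis scaleR_diff_right)
    moreover have "0 \<le> c *\<^sub>R pprt x" "0 \<le> c *\<^sub>R (- nprt x)"
      using split[of x] that by (intro scaleR_nonneg_nonneg; simp)+
    ultimately have "g (c *\<^sub>R x) = G (c *\<^sub>R pprt x) - G (c *\<^sub>R (- nprt x))"
      using g_diff by metis
    also have "\<dots> = c * g x"
      using scale[OF that split(2), of x] scale[OF that split(3), of x]
      by (simp only: g_def right_diff_distrib)
    finally show ?thesis .
  qed
  have "g (c *\<^sub>R x) = c * g x" for c x
  proof (cases c "0::real" rule: linorder_cases)
    case less
    then show ?thesis using g_pos[of "- c" x] g_minus[of "c *\<^sub>R x"] by simp
  next
    case equal
    then show ?thesis using g_diff[of 0 0] by simp
  next
    case greater
    then show ?thesis by (rule g_pos)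
  qed
  then show "linear g" using g_add by (intro linearI) simp_all
qed

text \<open>The supremum \<open>G\<close> is additive on the positive cone by Riesz decomposition,
  so it extends linearly. It tests \<open>f\<close> only at elements of \<open>I\<close>, so the
  bound \<open>N\<close> for \<open>f\<close> on \<open>I\<close> carries over to the whole
  space.\<close>

lemma minimal_positive_extension:
  fixes f :: "'a::banach_lattice \<Rightarrow> real"
  assumes I: "closed_ideal I" and f: "linear f" and pos: "\<And>x. 0 \<le> x \<Longrightarrow> 0 \<le> f x"
    and N: "0 \<le> N" "\<And>y. y \<in> I \<Longrightarrow> \<bar>f y\<bar> \<le> N * norm y"
  obtains g where "bounded_linear g" "\<And>x. 0 \<le> x \<Longrightarrow> g x \<le> f x"
    "\<And>y. y \<in> I \<Longrightarrow> g y = f y" "\<And>x. \<bar>g x\<bar> \<le> N * norm x"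
proof -
  define D where "D = (\<lambda>x. {y \<in> I. 0 \<le> y \<and> y \<le> x})"
  define G where "G = (\<lambda>x. SUP y\<in>D x. f y)"
  note sub = closed_ideal_imp_subspace[OF I]
  have mono: "f x \<le> f y" if "x \<le> y" for x y
    using pos[of "y - x"] that linear_diff[OF f, of y x] by simp
  have D0: "0 \<in> D x" if "0 \<le> x" for x
    using that subspace_0[OF sub] by (simp add: D_def)
  have bdd: "bdd_above (f ` D x)" for x
    by (rule bdd_aboveI2[where M = "f x"]) (simp add: D_def mono)
  have upper: "f y \<le> G x" if "y \<in> D x" for x y
    unfolding G_def using that bdd by (rule cSUP_upper)
  have least: "G x \<le> M" if "0 \<le> x" "\<And>y. y \<in> D x \<Longrightarrow> f y \<le> M" for x M
    unfolding G_def using that D0 by (intro cSUP_least) blast+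
  have nonneg: "0 \<le> G x" if "0 \<le> x" for x
    using upper[OF D0[OF that]] linear_0[OF f] by simp
  have G_add: "G (x + y) = G x + G y" if xy: "0 \<le> x" "0 \<le> y" for x y
  proof (rule antisym)
    show "G (x + y) \<le> G x + G y"
    proof (rule least)
      fix z assume z: "z \<in> D (x + y)"
      \<comment> \<open>Riesz decomposition: \<open>z\<close> is split into \<open>inf z x\<close>,
        below \<open>x\<close>, and the remainder, below \<open>y\<close>. The ideal property puts
        the first part in \<open>I\<close>, hence also the second.\<close>
      have 1: "inf z x \<in> D x"
        using z xy closed_ideal_between[OF I, of z "inf z x"] by (auto simp: D_def)
      have "z - y \<le> inf z x"
        using z xy by (auto simp: D_def algebra_simps)
      then have "z - inf z x \<le> y" by (simp only: diff_le_eq add.commute)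
      then have 2: "z - inf z x \<in> D y"
        using z 1 subspace_diff[OF sub, of z "inf z x"] inf_le1[of z x]
        by (simp only: D_def mem_Collect_eq diff_ge_0_iff_ge)
      show "f z \<le> G x + G y"
        using upper[OF 1] upper[OF 2] linear_diff[OF f, of z "inf z x"] by simp
    qed (use xy in simp)
    \<comment> \<open>For the reverse inequality the supremum is taken over \<open>b\<close> with
      \<open>a\<close> fixed, and then over \<open>a\<close>.\<close>
    have "f a + f b \<le> G (x + y)" if "a \<in> D x" "b \<in> D y" for a b
      using upper[of "a + b" "x + y"] that subspace_add[OF sub] linear_add[OF f, of a b]
      by (auto simp: D_def add_mono)
    then have "f a \<le> G (x + y) - G y" if "a \<in> D x" for a
      using least[OF xy(2), of "G (x + y) - f a"] that by (fastforce simp: algebra_simps)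
    then show "G x + G y \<le> G (x + y)"
      using least[OF xy(1), of "G (x + y) - G y"] by simp
  qed
  have G_scale_le: "c * G x \<le> G (c *\<^sub>R x)" if c: "0 < c" and x: "0 \<le> x" for c x
  proof -
    have "f y \<le> G (c *\<^sub>R x) / c" if "y \<in> D x" for y
      using upper[of "c *\<^sub>R y" "c *\<^sub>R x"] that c subspace_scale[OF sub] linear_scale[OF f]
      by (simp add: D_def scaleR_left_mono scaleR_nonneg_nonneg field_simps)
    then show ?thesis
      using least[OF x, of "G (c *\<^sub>R x) / c"] c by (simp add: field_simps)
  qed
  have G_scale: "G (c *\<^sub>R x) = c * G x" if c: "0 < c" and x: "0 \<le> x" for c x
    \<comment> \<open>Scaling back by \<open>1 / c\<close> turns the one-sided estimate into the
      opposite one.\<close>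
    using G_scale_le[OF c x] G_scale_le[of "1 / c" "c *\<^sub>R x"] c x
    by (simp add: scaleR_nonneg_nonneg field_simps)
  obtain g where g: "linear g" "\<And>x. 0 \<le> x \<Longrightarrow> g x = G x"
    using positive_cone_extension[of G] G_add G_scale by metis
  \<comment> \<open>For positive \<open>y\<close> in \<open>I\<close> the supremum is attained at
    \<open>y\<close> itself, the largest element of \<open>D y\<close>.\<close>
  have g_f: "g y = f y" if "y \<in> I" "0 \<le> y" for y
    using that upper[of y y] least[of y "f y"] g(2)[of y] mono by (force simp: D_def)
  show ?thesis
  proof
    show "g x \<le> f x" if "0 \<le> x" for x
      using least[OF that, of "f x"] g(2)[OF that] mono by (simp add: D_def)
    show "g y = f y" if "y \<in> I" for y
    proof -
      have abs: "\<bar>y\<bar> \<in> I"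
        using I that unfolding closed_ideal_def by (metis abs_idempotent order_refl)
      \<comment> \<open>Both parts lie between 0 and \<open>\<bar>y\<bar>\<close>, so agreement on
        the positive elements of \<open>I\<close> suffices.\<close>
      have "pprt y \<in> I" "- nprt y \<in> I"
        using abs_prts[of y] by (auto intro!: closed_ideal_between[OF I abs])
      then have "g (pprt y) - g (- nprt y) = f (pprt y) - f (- nprt y)"
        using g_f by simp
      then show ?thesis
        using prts[of y] linear_diff[OF g(1), of "pprt y" "- nprt y"]
          linear_diff[OF f, of "pprt y" "- nprt y"] by simp
    qed
    show bound: "\<bar>g x\<bar> \<le> N * norm x" for x
    proof -
      have G_le: "G \<bar>x\<bar> \<le> N * norm x"
      proof (rule least)
        fix y assume y: "y \<in> D \<bar>x\<bar>"
        have "f y \<le> N * norm y" using N(2)[of y] y by (simp add: D_def)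
        also have "\<dots> \<le> N * norm x"
          using y N(1) norm_mono_positive[of y "\<bar>x\<bar>"]
          by (intro mult_left_mono) (simp_all add: D_def norm_abs_lattice)
        finally show "f y \<le> N * norm x" .
      qed simp
      have g_nonneg: "0 \<le> g y" if "0 \<le> y" for y
        using nonneg[OF that] g(2)[OF that] by simp
      \<comment> \<open>Positivity of \<open>g\<close> reduces the bound at \<open>x\<close> to the
        one at \<open>\<bar>x\<bar>\<close>, where \<open>g\<close> is the supremum
        \<open>G\<close>.\<close>
      have "0 \<le> g (\<bar>x\<bar> - x)" "0 \<le> g (\<bar>x\<bar> - (- x))"
        by (intro g_nonneg; simp only: diff_ge_0_iff_ge abs_ge_self abs_ge_minus_self)+
      then have "\<bar>g x\<bar> \<le> g \<bar>x\<bar>"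
        using linear_diff[OF g(1)] linear_neg[OF g(1)] by (simp only: abs_le_iff) simp
      then show ?thesis using G_le g(2)[of "\<bar>x\<bar>"] by simp
    qed
    show "bounded_linear g"
      using g(1) bound
      by (intro bounded_linear_intro[of g N])
        (simp_all add: linear_add linear_scale mult.commute)
  qed
qed

section \<open>Functionals that factor through the quotient\<close>

text \<open>A functional vanishing on \<open>I\<close> is constant on each coset, so
  \<open>the_elem\<close> picks its single value there. The last estimate holds because the quotient
  map does not increase norms.\<close>

lemma functional_on_quotient:
  fixes h :: "'a::banach_lattice \<Rightarrow> real"
  assumes I: "closed_ideal I" and h: "bounded_linear h" and zero: "\<And>y. y \<in> I \<Longrightarrow> h y = 0"
  obtains q where "\<And>x. q (coset I x) = h x" "q \<in> dual_space (quotient_lattice I)"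
    "\<And>x. \<bar>h x\<bar> \<le> dual_norm (quotient_lattice I) q * norm x"
proof -
  define q where "q = (\<lambda>A. the_elem (h ` A))"
  interpret h: bounded_linear h by fact
  note sub = closed_ideal_imp_subspace[OF I]
  note simps = quotient_lattice_simps[OF I]
  have carrier: "carrier (quotient_lattice I) = range (coset I)"
    by (simp add: quotient_lattice_def)
  have "h ` coset I x = {h x}" for x
    using subspace_0[OF sub] zero by (force simp: coset_def h.add)
  then have q: "q (coset I x) = h x" for x by (simp add: q_def)
  have norm_le: "infdist x I \<le> norm x" for x
    using infdist_le[OF subspace_0[OF sub], of x] by simp
  obtain K where K: "0 < K" "\<And>x. norm (h x) \<le> norm x * K" using h.pos_bounded by blast
  have K': "\<bar>h x\<bar> \<le> K * infdist x I" for x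
  proof -
    \<comment> \<open>Since \<open>h x = h (x - i)\<close> for all \<open>i\<close> in
      \<open>I\<close>, the left side is a lower bound for all the distances
      \<open>dist x i\<close>.\<close>
    have "\<bar>h x\<bar> / K \<le> infdist x I"
      unfolding infdist_def using subspace_0[OF sub]
    proof (simp, intro conjI impI cINF_greatest)
      fix i assume "i \<in> I"
      then show "\<bar>h x\<bar> / K \<le> dist x i"
        using K(2)[of "x - i"] K(1) zero[of i] by (simp add: h.diff dist_norm field_simps)
    qed auto
    then show ?thesis using K(1) by (simp add: field_simps)
  qed
  have dual: "q \<in> dual_space (quotient_lattice I)"
    using K' by (auto simp: dual_space_def carrier simps q h.add h.scale)
  have nonneg: "0 \<le> norm_vec (quotient_lattice I) A" if "A \<in> carrier (quotient_lattice I)" for A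
    using that by (auto simp: carrier simps infdist_nonneg)
  have "\<bar>h x\<bar> \<le> dual_norm (quotient_lattice I) q * norm x" for x
    using h subspace_UNIV _ UNIV_I
  proof (rule bound_from_unit_ball)
    fix x :: 'a assume "norm x \<le> 1"
    then show "\<bar>h x\<bar> \<le> dual_norm (quotient_lattice I) q"
      using dual_norm_upper[OF dual nonneg, of "coset I x"] norm_le[of x]
      by (simp add: q carrier simps(4))
  qed
  then show ?thesis using that q dual by blast
qed

section \<open>Splitting the sequence along the ideal\<close>

theorem proposition2p12:
  fixes I :: "'a::banach_lattice set"
  assumes "closed_ideal I"
    and "dual_positive_Schur (sub_lattice I)"
    and "dual_positive_Schur (quotient_lattice I)"
  shows "dual_positive_Schur (whole_lattice :: 'a ordered_normed_space)"
  unfolding dual_positive_Schur_whole_lattice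
proof (intro allI impI)
  fix f :: "nat \<Rightarrow> 'a \<Rightarrow>\<^sub>L real"
  assume pos: "\<forall>n x. 0 \<le> x \<longrightarrow> 0 \<le> blinfun_apply (f n) x"
    and null: "\<forall>x. (\<lambda>n. blinfun_apply (f n) x) \<longlonglongrightarrow> 0"
  note sub = closed_ideal_imp_subspace[OF assms(1)]
  note simps = quotient_lattice_simps[OF assms(1)]
  have bl: "bounded_linear (blinfun_apply (f n))" for n
    by (rule blinfun.bounded_linear_right)
  define N where "N = (\<lambda>n. dual_norm (sub_lattice I) (blinfun_apply (f n)))"
  \<comment> \<open>\<open>sub_lattice I\<close> only sees values on \<open>I\<close>, so
    \<open>f n\<close> itself serves as its own restriction.\<close>
  have N_null: "N \<longlonglongrightarrow> 0"
    using assms(2) pos null bounded_linear_in_dual_space_sub_lattice[OF bl, where S = I]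
    unfolding dual_positive_Schur_def norm_null_def N_def positive_functional_def
      weak_star_null_def
    by (elim allE[of _ "\<lambda>n. blinfun_apply (f n)"]) simp
  have "\<exists>g. bounded_linear g \<and> (\<forall>x\<ge>0. g x \<le> f n x) \<and> (\<forall>y\<in>I. g y = f n y) \<and>
      (\<forall>x. \<bar>g x\<bar> \<le> N n * norm x)" for n
  proof (rule minimal_positive_extension[OF assms(1), of "blinfun_apply (f n)" "N n"])
    show "linear (blinfun_apply (f n))" using bl by (rule bounded_linear.linear)
    show "0 \<le> N n" unfolding N_def using bl sub by (rule dual_norm_sub_lattice_nonneg)
    show "\<bar>f n y\<bar> \<le> N n * norm y" if "y \<in> I" for y
      unfolding N_def using bl sub that by (rule bound_dual_norm_sub_lattice)
  qed (use pos in blast)+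
  then obtain g where g: "\<And>n. bounded_linear (g n)" "\<And>n x. 0 \<le> x \<Longrightarrow> g n x \<le> f n x"
      "\<And>n y. y \<in> I \<Longrightarrow> g n y = f n y" "\<And>n x. \<bar>g n x\<bar> \<le> N n * norm x"
    by metis
  define h where "h = (\<lambda>n x. f n x - g n x)"
  have h_bl: "bounded_linear (h n)" for n
    unfolding h_def using bl g(1) by (rule bounded_linear_sub)
  have h_zero: "h n y = 0" if "y \<in> I" for n y
    using g(3) that by (simp add: h_def)
  have "\<exists>q. (\<forall>x. q (coset I x) = h n x) \<and> q \<in> dual_space (quotient_lattice I) \<and>
      (\<forall>x. \<bar>h n x\<bar> \<le> dual_norm (quotient_lattice I) q * norm x)" for n
    using functional_on_quotient[OF assms(1) h_bl[of n] h_zero] by metis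
  then obtain q where q: "\<And>n x. q n (coset I x) = h n x"
      "\<And>n. q n \<in> dual_space (quotient_lattice I)"
      "\<And>n x. \<bar>h n x\<bar> \<le> dual_norm (quotient_lattice I) (q n) * norm x"
    by metis
  define M where "M = (\<lambda>n. dual_norm (quotient_lattice I) (q n))"
  have carrier: "carrier (quotient_lattice I) = range (coset I)"
    by (simp add: quotient_lattice_def)
  have q_pos: "positive_functional (quotient_lattice I) (q n)" for n
  proof -
    \<comment> \<open>A coset is positive when some representative \<open>x + i\<close> is; there
      \<open>h n\<close> is nonnegative because \<open>g n\<close> lies below \<open>f n\<close>,
      and it has the same value at \<open>x\<close>.\<close>
    have "0 \<le> h n x" if "i \<in> I" "0 \<le> x + i" for x i
      using g(2)[OF that(2), of n] h_zero[OF that(1), of n]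
        linear_add[OF bounded_linear.linear[OF h_bl[of n]], of x i]
      by (simp add: h_def)
    then show ?thesis
      by (auto simp: positive_functional_def carrier simps q(1))
  qed
  have q_null: "weak_star_null (quotient_lattice I) q"
  proof -
    \<comment> \<open>The norm bound by \<open>N n\<close> makes \<open>g\<close> pointwise null,
      which passes weak* nullity from \<open>f\<close> to \<open>h\<close>.\<close>
    have "(\<lambda>n. g n x) \<longlonglongrightarrow> 0" for x
      using g(4) tendsto_mult_left_zero[OF N_null, of "norm x"]
      by (intro Lim_null_comparison[of "\<lambda>n. g n x" "\<lambda>n. N n * norm x"]) simp_all
    then have "(\<lambda>n. h n x) \<longlonglongrightarrow> 0" for x
      unfolding h_def using null tendsto_diff[of "\<lambda>n. f n x" 0 sequentially] by fastforce
    then show ?thesis by (auto simp: weak_star_null_def carrier q(1))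
  qed
  have M_null: "M \<longlonglongrightarrow> 0"
    using assms(3) q(2) q_pos q_null
    by (auto simp: dual_positive_Schur_def norm_null_def M_def)
  have bound: "norm (f n x) \<le> (M n + N n) * norm x" for n x
    using q(3)[of n x] g(4)[of n x] by (simp add: h_def M_def distrib_right)
  \<comment> \<open>The absolute value supplies the nonnegative constant demanded by
    \<open>norm_blinfun_bound\<close>.\<close>
  have "norm (f n) \<le> \<bar>M n + N n\<bar>" for n
    using order_trans[OF bound mult_right_mono[OF abs_ge_self norm_ge_zero]]
    by (intro norm_blinfun_bound) simp_all
  moreover have "(\<lambda>n. \<bar>M n + N n\<bar>) \<longlonglongrightarrow> 0"
    using tendsto_rabs_zero[OF tendsto_add_zero[OF M_null N_null]] .
  ultimately show "f \<longlonglongrightarrow> 0"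
    by (intro Lim_null_comparison[of f "\<lambda>n. \<bar>M n + N n\<bar>"]) simp_all
qed

end
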